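(* Let $V=\mathbb{C}(z)$ or $V=\mathbb{C}((z))$, and consider the set $$\mathcal{S}:=\{\rho\in\mathrm{Hom}_{\text{Lie-alg}}(\mathfrak{sl}(2),\mathrm{Diff}(V)):\rho(L_0)\text{ is of first order}\}.$$ Every representation $\rho\in\mathcal{S}$ is a Casimir representation.
   Context: $\mathfrak{sl}(2)$ is the complex Lie algebra with basis $L_{-1},L_0,L_1$ and $[L_i,L_j]=(i-j)L_{i+j}$. $\mathrm{Diff}(V)$ is the Lie algebra (under commutator) of differential operators on $V$: finite sums $\sum_{j=0}^k\xi_j\partial^j$ with $\xi_j\in V$, $\partial=\frac{\partial}{\partial z}$; the order is $k$ if $\xi_k\ne0$; "first order" means order exactly $1$. The Casimir element is $\mathcal{C}=4\left((L_0-\frac12)^2-L_{-1}L_1\right)=4\left((L_0+\frac12)^2-L_1L_{-1}\right)$ in the universal enveloping algebra of $\mathfrak{sl}(2)$; $\rho(\mathcal{C})$ is its image under the induced associative algebra homomorphism. $\rho$ is a Casimir representation if $\rho(\mathcal{C})$ acts by a constant, which is then written $\rho(\mathcal{C})=(2\mu+1)^2$ with $\mu$ the unique such complex number in $\mathbb{C}_{\mathrm{sl}}:=\{\mu\in\mathbb{C}:\mathrm{Re}(\mu)=-\frac12,\ \mathrm{Im}(\mu)\ge0\}\sqcup\{\mu\in\mathbb{C}:\mathrm{Re}(\mu)>-\frac12\}$. *)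

theory Defs
  imports "HOL-Computational_Algebra.Computational_Algebra"
begin

section \<open>The Lie algebra \<open>sl(2)\<close>\<close>

datatype sl2 = Sl2 (coeff_m1: complex) (coeff_0: complex) (coeff_1: complex)

definition sl2_coeff :: "sl2 \<Rightarrow> int \<Rightarrow> complex" where
  "sl2_coeff x i =
     (if i = -1 then coeff_m1 x else if i = 0 then coeff_0 x else if i = 1 then coeff_1 x else 0)"

text \<open>The basis vectors \<open>L\<^sub>-\<^sub>1\<close>, \<open>L\<^sub>0\<close>, \<open>L\<^sub>1\<close> are \<open>sl2_L (-1)\<close>, \<open>sl2_L 0\<close>, \<open>sl2_L 1\<close>;
  for every other index \<open>sl2_L i\<close> is zero.\<close>

definition sl2_L :: "int \<Rightarrow> sl2" where
  "sl2_L i = Sl2 (of_bool (i = -1)) (of_bool (i = 0)) (of_bool (i = 1))"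

instantiation sl2 :: ab_group_add
begin
definition zero_sl2 :: sl2 where "0 = Sl2 0 0 0"
definition plus_sl2 :: "sl2 \<Rightarrow> sl2 \<Rightarrow> sl2" where
  "x + y = Sl2 (coeff_m1 x + coeff_m1 y) (coeff_0 x + coeff_0 y) (coeff_1 x + coeff_1 y)"
definition uminus_sl2 :: "sl2 \<Rightarrow> sl2" where
  "- x = Sl2 (- coeff_m1 x) (- coeff_0 x) (- coeff_1 x)"
definition minus_sl2 :: "sl2 \<Rightarrow> sl2 \<Rightarrow> sl2" where
  "x - y = Sl2 (coeff_m1 x - coeff_m1 y) (coeff_0 x - coeff_0 y) (coeff_1 x - coeff_1 y)"
instance
  by standard
    (simp_all add: zero_sl2_def plus_sl2_def uminus_sl2_def minus_sl2_def sl2.expand)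
end

definition sl2_scale :: "complex \<Rightarrow> sl2 \<Rightarrow> sl2" where
  "sl2_scale c x = Sl2 (c * coeff_m1 x) (c * coeff_0 x) (c * coeff_1 x)"

text \<open>The bilinear extension of \<open>[L\<^sub>i, L\<^sub>j] = (i - j) L\<^sub>i\<^sub>+\<^sub>j\<close>.\<close>

definition sl2_bracket :: "sl2 \<Rightarrow> sl2 \<Rightarrow> sl2" where
  "sl2_bracket x y =
     (\<Sum>i\<in>{-1,0,1}. \<Sum>j\<in>{-1,0,1}.
        sl2_scale (sl2_coeff x i * sl2_coeff y j * of_int (i - j)) (sl2_L (i + j)))"

lemmas sl2_defs = zero_sl2_def plus_sl2_def uminus_sl2_def minus_sl2_def sl2_scale_def
  sl2_coeff_def sl2_L_def

lemma sl2_bracket_eq: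
  "sl2_bracket x y =
     Sl2 (coeff_0 x * coeff_m1 y - coeff_m1 x * coeff_0 y)
         (2 * (coeff_1 x * coeff_m1 y - coeff_m1 x * coeff_1 y))
         (coeff_1 x * coeff_0 y - coeff_0 x * coeff_1 y)"
  by (simp add: sl2_bracket_def sl2_defs)

lemma sl2_bracket_L:
  assumes "i \<in> {-1,0,1}" "j \<in> {-1,0,1}"
  shows "sl2_bracket (sl2_L i) (sl2_L j) = sl2_scale (of_int (i - j)) (sl2_L (i + j))"
  using assms by (auto simp: sl2_bracket_eq sl2_defs)

lemma sl2_basis:
  "x = sl2_scale (coeff_m1 x) (sl2_L (-1)) + sl2_scale (coeff_0 x) (sl2_L 0)
       + sl2_scale (coeff_1 x) (sl2_L 1)"
  by (simp add: sl2_defs)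

lemma sl2_bracket_self: "sl2_bracket x x = 0"
  by (simp add: sl2_bracket_eq zero_sl2_def)

lemma sl2_jacobi:
  "sl2_bracket x (sl2_bracket y w) + sl2_bracket y (sl2_bracket w x)
     + sl2_bracket w (sl2_bracket x y) = 0"
  by (simp add: sl2_bracket_eq zero_sl2_def plus_sl2_def algebra_simps)


section \<open>The universal enveloping algebra of \<open>sl(2)\<close>\<close>

text \<open>The quotient of the algebra of terms over \<open>sl(2)\<close> by the congruence generated by the axioms of
  unital associative complex algebras, the linearity of the inclusion of \<open>sl(2)\<close>, and
  \<open>x y = y x + [x, y]\<close>.\<close>

datatype uterm = UConst complex | UGen sl2 | UAdd uterm uterm | UMul uterm uterm

inductive ueq :: "uterm \<Rightarrow> uterm \<Rightarrow> bool" where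
  ueq_refl: "ueq a a"
| ueq_sym: "ueq a b \<Longrightarrow> ueq b a"
| ueq_trans: "ueq a b \<Longrightarrow> ueq b c \<Longrightarrow> ueq a c"
| ueq_add_cong: "ueq a a' \<Longrightarrow> ueq b b' \<Longrightarrow> ueq (UAdd a b) (UAdd a' b')"
| ueq_mul_cong: "ueq a a' \<Longrightarrow> ueq b b' \<Longrightarrow> ueq (UMul a b) (UMul a' b')"
| ueq_add_assoc: "ueq (UAdd (UAdd a b) c) (UAdd a (UAdd b c))"
| ueq_add_comm: "ueq (UAdd a b) (UAdd b a)"
| ueq_add_zero: "ueq (UAdd (UConst 0) a) a"
| ueq_add_inv: "ueq (UAdd (UMul (UConst (-1)) a) a) (UConst 0)"
| ueq_mul_assoc: "ueq (UMul (UMul a b) c) (UMul a (UMul b c))"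
| ueq_one_mul: "ueq (UMul (UConst 1) a) a"
| ueq_distrib_right: "ueq (UMul (UAdd a b) c) (UAdd (UMul a c) (UMul b c))"
| ueq_distrib_left: "ueq (UMul a (UAdd b c)) (UAdd (UMul a b) (UMul a c))"
| ueq_const_add: "ueq (UConst (s + t)) (UAdd (UConst s) (UConst t))"
| ueq_const_mul: "ueq (UConst (s * t)) (UMul (UConst s) (UConst t))"
| ueq_const_central: "ueq (UMul (UConst s) a) (UMul a (UConst s))"
| ueq_gen_add: "ueq (UGen (x + y)) (UAdd (UGen x) (UGen y))"
| ueq_gen_scale: "ueq (UGen (sl2_scale s x)) (UMul (UConst s) (UGen x))"
| ueq_gen_bracket: "ueq (UMul (UGen x) (UGen y)) (UAdd (UMul (UGen y) (UGen x)) (UGen (sl2_bracket x y)))"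

quotient_type usl2 = uterm / ueq
  by (rule equivpI; blast intro: reflpI sympI transpI ueq_refl ueq_sym ueq_trans)

text \<open>\<open>u_scalar\<close> and \<open>u_incl\<close> are the canonical maps of the complex numbers and of \<open>sl(2)\<close>
  into the enveloping algebra.\<close>

lift_definition u_scalar :: "complex \<Rightarrow> usl2" is UConst .
lift_definition u_incl :: "sl2 \<Rightarrow> usl2" is UGen .

primrec uterm_augment :: "uterm \<Rightarrow> complex" where
  "uterm_augment (UConst c) = c"
| "uterm_augment (UGen x) = 0"
| "uterm_augment (UAdd a b) = uterm_augment a + uterm_augment b"
| "uterm_augment (UMul a b) = uterm_augment a * uterm_augment b"

lemma ueq_augment: "ueq a b \<Longrightarrow> uterm_augment a = uterm_augment b"
  by (induction rule: ueq.induct) (simp_all add: algebra_simps)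

instantiation usl2 :: ring_1
begin
lift_definition zero_usl2 :: usl2 is "UConst 0" .
lift_definition one_usl2 :: usl2 is "UConst 1" .
lift_definition plus_usl2 :: "usl2 \<Rightarrow> usl2 \<Rightarrow> usl2" is UAdd by (rule ueq_add_cong)
lift_definition times_usl2 :: "usl2 \<Rightarrow> usl2 \<Rightarrow> usl2" is UMul by (rule ueq_mul_cong)
lift_definition uminus_usl2 :: "usl2 \<Rightarrow> usl2" is "UMul (UConst (-1))"
  by (rule ueq_mul_cong[OF ueq_refl])
definition minus_usl2 :: "usl2 \<Rightarrow> usl2 \<Rightarrow> usl2" where "minus_usl2 u v = u + - v"
instance
proof
  fix a b c :: usl2
  show "a * b * c = a * (b * c)" by transfer (rule ueq_mul_assoc)
  show "1 * a = a" by transfer (rule ueq_one_mul)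
  show "a * 1 = a" by transfer (metis ueq_const_central ueq_one_mul ueq_sym ueq_trans)
  show "a + b + c = a + (b + c)" by transfer (rule ueq_add_assoc)
  show "a + b = b + a" by transfer (rule ueq_add_comm)
  show "0 + a = a" by transfer (rule ueq_add_zero)
  show "- a + a = 0" by transfer (rule ueq_add_inv)
  show "a - b = a + - b" by (rule minus_usl2_def)
  show "(a + b) * c = a * c + b * c" by transfer (rule ueq_distrib_right)
  show "a * (b + c) = a * b + a * c" by transfer (rule ueq_distrib_left)
  show "(0::usl2) \<noteq> 1" by transfer (auto dest: ueq_augment)
qed
end

lemma u_scalar_0: "u_scalar 0 = 0" and u_scalar_1: "u_scalar 1 = 1"
  by (transfer, rule ueq_refl)+

lemma u_scalar_add: "u_scalar (s + t) = u_scalar s + u_scalar t"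
  by transfer (rule ueq_const_add)

lemma u_scalar_mult: "u_scalar (s * t) = u_scalar s * u_scalar t"
  by transfer (rule ueq_const_mul)

lemma u_scalar_commute: "u_scalar s * u = u * u_scalar s"
  by transfer (rule ueq_const_central)

lemma u_incl_add: "u_incl (x + y) = u_incl x + u_incl y"
  by transfer (rule ueq_gen_add)

lemma u_incl_scale: "u_incl (sl2_scale s x) = u_scalar s * u_incl x"
  by transfer (rule ueq_gen_scale)

lemma u_incl_bracket: "u_incl (sl2_bracket x y) = u_incl x * u_incl y - u_incl y * u_incl x"
proof -
  have "u_incl x * u_incl y = u_incl y * u_incl x + u_incl (sl2_bracket x y)"
    by transfer (rule ueq_gen_bracket)
  thus ?thesis by simp
qed

definition casimir :: usl2 where
  "casimir = 4 * ((u_incl (sl2_L 0) - u_scalar (1/2))\<^sup>2 - u_incl (sl2_L (-1)) * u_incl (sl2_L 1))"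

lemma casimir_alt:
  "casimir = 4 * ((u_incl (sl2_L 0) + u_scalar (1/2))\<^sup>2 - u_incl (sl2_L 1) * u_incl (sl2_L (-1)))"
proof -
  define h a b t where "h = u_incl (sl2_L 0)" and "a = u_incl (sl2_L (-1))"
    and "b = u_incl (sl2_L 1)" and "t = u_scalar (1/2)"
  have t: "t + t = 1" "\<And>u. t * u = u * t"
    unfolding t_def by (simp_all add: u_scalar_commute u_scalar_1 flip: u_scalar_add)
  have "sl2_bracket (sl2_L 1) (sl2_L (-1)) = sl2_L 0 + sl2_L 0"
    by (simp add: sl2_bracket_eq sl2_defs)
  hence ba: "b * a = a * b + (h + h)"
    using u_incl_bracket[of "sl2_L 1" "sl2_L (-1)"]
    by (simp add: h_def a_def b_def u_incl_add algebra_simps)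
  have "h * t + h * t = h"
    using distrib_left[of h t t] t(1) by simp
  moreover have "(h + t)\<^sup>2 - (h - t)\<^sup>2 = (h * t + h * t) + (h * t + h * t)"
    by (simp add: power2_eq_square algebra_simps t(2)[of h])
  ultimately have "(h + t)\<^sup>2 - (h - t)\<^sup>2 = h + h"
    by simp
  hence "(h - t)\<^sup>2 - a * b = (h + t)\<^sup>2 - b * a"
    unfolding ba by (simp add: algebra_simps)
  thus ?thesis
    by (simp add: casimir_def h_def a_def b_def t_def)
qed


section \<open>Differential operators\<close>

text \<open>In the following \<open>\<kappa>\<close> is the embedding of the complex numbers into the field \<open>V\<close>
  and \<open>\<delta>\<close> the derivation of \<open>V\<close>. Differential operators are regarded as maps on \<open>V\<close>.\<close>

definition diff_op :: "('v::field \<Rightarrow> 'v) \<Rightarrow> nat \<Rightarrow> (nat \<Rightarrow> 'v) \<Rightarrow> 'v \<Rightarrow> 'v" where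
  "diff_op \<delta> k \<xi> = (\<lambda>f. \<Sum>j\<le>k. \<xi> j * (\<delta> ^^ j) f)"

definition Diff :: "('v::field \<Rightarrow> 'v) \<Rightarrow> ('v \<Rightarrow> 'v) set" where
  "Diff \<delta> = {diff_op \<delta> k \<xi> | k \<xi>. True}"

definition has_order :: "('v::field \<Rightarrow> 'v) \<Rightarrow> ('v \<Rightarrow> 'v) \<Rightarrow> nat \<Rightarrow> bool" where
  "has_order \<delta> P k \<longleftrightarrow> (\<exists>\<xi>. P = diff_op \<delta> k \<xi> \<and> \<xi> k \<noteq> 0)"

definition op_commutator :: "('v::field \<Rightarrow> 'v) \<Rightarrow> ('v \<Rightarrow> 'v) \<Rightarrow> 'v \<Rightarrow> 'v" where
  "op_commutator P Q = (\<lambda>f. P (Q f) - Q (P f))"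

definition lie_homs :: "(complex \<Rightarrow> 'v::field) \<Rightarrow> ('v \<Rightarrow> 'v) \<Rightarrow> (sl2 \<Rightarrow> 'v \<Rightarrow> 'v) set" where
  "lie_homs \<kappa> \<delta> = {\<rho>.
     (\<forall>x. \<rho> x \<in> Diff \<delta>) \<and>
     (\<forall>x y. \<rho> (x + y) = (\<lambda>f. \<rho> x f + \<rho> y f)) \<and>
     (\<forall>c x. \<rho> (sl2_scale c x) = (\<lambda>f. \<kappa> c * \<rho> x f)) \<and>
     (\<forall>x y. \<rho> (sl2_bracket x y) = op_commutator (\<rho> x) (\<rho> y))}"

definition alg_homs :: "(complex \<Rightarrow> 'v::field) \<Rightarrow> ('v \<Rightarrow> 'v) \<Rightarrow> (usl2 \<Rightarrow> 'v \<Rightarrow> 'v) set" where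
  "alg_homs \<kappa> \<delta> = {\<Phi>.
     (\<forall>u. \<Phi> u \<in> Diff \<delta>) \<and>
     (\<forall>u v. \<Phi> (u + v) = (\<lambda>f. \<Phi> u f + \<Phi> v f)) \<and>
     (\<forall>c u. \<Phi> (u_scalar c * u) = (\<lambda>f. \<kappa> c * \<Phi> u f)) \<and>
     (\<forall>u v. \<Phi> (u * v) = \<Phi> u \<circ> \<Phi> v) \<and>
     \<Phi> 1 = id}"

text \<open>The unique extension of \<open>\<rho>\<close> to the enveloping algebra; see \<open>ex1_alg_hom\<close> below.\<close>

definition induced_hom ::
  "(complex \<Rightarrow> 'v::field) \<Rightarrow> ('v \<Rightarrow> 'v) \<Rightarrow> (sl2 \<Rightarrow> 'v \<Rightarrow> 'v) \<Rightarrow> usl2 \<Rightarrow> 'v \<Rightarrow> 'v" where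
  "induced_hom \<kappa> \<delta> \<rho> = (THE \<Phi>. \<Phi> \<in> alg_homs \<kappa> \<delta> \<and> (\<forall>x. \<Phi> (u_incl x) = \<rho> x))"

definition casimir_representation ::
  "(complex \<Rightarrow> 'v::field) \<Rightarrow> ('v \<Rightarrow> 'v) \<Rightarrow> (sl2 \<Rightarrow> 'v \<Rightarrow> 'v) \<Rightarrow> bool" where
  "casimir_representation \<kappa> \<delta> \<rho> \<longleftrightarrow> (\<exists>c. induced_hom \<kappa> \<delta> \<rho> casimir = (\<lambda>f. \<kappa> c * f))"

text \<open>The constant may equivalently be written \<open>(2 \<mu> + 1)\<^sup>2\<close> with a unique \<open>\<mu>\<close> in \<open>C_sl\<close>;
  see \<open>ex1_C_sl\<close> and \<open>casimir_representation_iff\<close>.\<close>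

definition C_sl :: "complex set" where
  "C_sl = {\<mu>. Re \<mu> = -1/2 \<and> Im \<mu> \<ge> 0} \<union> {\<mu>. Re \<mu> > -1/2}"

definition first_order_reps ::
  "(complex \<Rightarrow> 'v::field) \<Rightarrow> ('v \<Rightarrow> 'v) \<Rightarrow> (sl2 \<Rightarrow> 'v \<Rightarrow> 'v) set" where
  "first_order_reps \<kappa> \<delta> = {\<rho> \<in> lie_homs \<kappa> \<delta>. has_order \<delta> (\<rho> (sl2_L 0)) 1}"

lemma ex1_C_sl: "\<exists>!\<mu>. \<mu> \<in> C_sl \<and> c = (2 * \<mu> + 1)\<^sup>2"
proof (rule ex1I)
  have "0 < Re (csqrt c) \<or> Re (csqrt c) = 0 \<and> 0 \<le> Im (csqrt c)"
    by (rule csqrt_principal)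
  hence "(w - 1) / 2 \<in> C_sl" if "w = csqrt c" for w
    unfolding C_sl_def that[symmetric] by auto
  moreover have "2 * ((w - 1) / 2) + 1 = w" for w :: complex
    by (simp add: field_simps)
  ultimately show "(csqrt c - 1) / 2 \<in> C_sl \<and> c = (2 * ((csqrt c - 1) / 2) + 1)\<^sup>2"
    by (simp only: power2_csqrt)
next
  fix \<mu> assume \<mu>: "\<mu> \<in> C_sl \<and> c = (2 * \<mu> + 1)\<^sup>2"
  hence "csqrt c = 2 * \<mu> + 1"
    by (intro csqrt_unique) (auto simp: C_sl_def)
  thus "\<mu> = (csqrt c - 1) / 2" by simp
qed

lemma casimir_representation_iff:
  "casimir_representation \<kappa> \<delta> \<rho> \<longleftrightarrow>
     (\<exists>\<mu>\<in>C_sl. induced_hom \<kappa> \<delta> \<rho> casimir = (\<lambda>f. \<kappa> ((2 * \<mu> + 1)\<^sup>2) * f))"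
  unfolding casimir_representation_def using ex1_C_sl by metis


subsection \<open>Well-definedness\<close>

locale differential_field =
  fixes \<kappa> :: "complex \<Rightarrow> 'v::field" and \<delta> :: "'v \<Rightarrow> 'v" and z :: 'v
  assumes \<kappa>_add: "\<kappa> (a + b) = \<kappa> a + \<kappa> b"
    and \<kappa>_mult: "\<kappa> (a * b) = \<kappa> a * \<kappa> b"
    and \<kappa>_1: "\<kappa> 1 = 1"
    and \<delta>_add: "\<delta> (f + g) = \<delta> f + \<delta> g"
    and \<delta>_mult: "\<delta> (f * g) = \<delta> f * g + f * \<delta> g"
    and \<delta>_\<kappa>: "\<delta> (\<kappa> a) = 0"
    and \<delta>_z: "\<delta> z = 1"
begin

lemma \<kappa>_0: "\<kappa> 0 = 0"
  by (metis \<kappa>_add add_0 add_cancel_right_right)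

lemma \<kappa>_uminus: "\<kappa> (- a) = - \<kappa> a"
  using \<kappa>_add[of "-a" a] \<kappa>_0 by (simp add: eq_neg_iff_add_eq_0)

lemma \<kappa>_eq_0_iff: "\<kappa> a = 0 \<longleftrightarrow> a = 0"
  using \<kappa>_mult[of a "inverse a"] \<kappa>_0 \<kappa>_1 by (cases "a = 0") auto

lemma \<kappa>_of_nat: "\<kappa> (of_nat n) = of_nat n"
  by (induction n) (simp_all add: \<kappa>_0 \<kappa>_1 \<kappa>_add)

lemma of_nat_eq_0_iff': "(of_nat n :: 'v) = 0 \<longleftrightarrow> n = 0"
  by (metis \<kappa>_of_nat \<kappa>_eq_0_iff of_nat_eq_0_iff)

lemma \<delta>_0: "\<delta> 0 = 0"
  by (metis \<delta>_add add_0 add_cancel_right_right)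

lemma \<delta>_sum: "\<delta> (sum g A) = (\<Sum>i\<in>A. \<delta> (g i))"
  by (induction A rule: infinite_finite_induct) (simp_all add: \<delta>_0 \<delta>_add)

lemma \<delta>_scale: "\<delta> (\<kappa> c * f) = \<kappa> c * \<delta> f"
  by (simp add: \<delta>_mult \<delta>_\<kappa>)

lemma funpow_\<delta>_add: "(\<delta> ^^ j) (f + g) = (\<delta> ^^ j) f + (\<delta> ^^ j) g"
  by (induction j) (simp_all add: \<delta>_add)

lemma funpow_\<delta>_scale: "(\<delta> ^^ j) (\<kappa> c * f) = \<kappa> c * (\<delta> ^^ j) f"
  by (induction j) (simp_all add: \<delta>_scale)

lemma Diff_add: assumes "P \<in> Diff \<delta>" shows "P (f + g) = P f + P g"
  using assms by (auto simp: Diff_def diff_op_def funpow_\<delta>_add distrib_left sum.distrib)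

lemma Diff_scale: assumes "P \<in> Diff \<delta>" shows "P (\<kappa> c * f) = \<kappa> c * P f"
  using assms
  by (auto simp: Diff_def diff_op_def funpow_\<delta>_scale sum_distrib_left intro!: sum.cong)

lemma diff_op_pad:
  assumes "k \<le> m"
  shows "diff_op \<delta> k \<xi> = diff_op \<delta> m (\<lambda>j. if j \<le> k then \<xi> j else 0)"
proof
  fix f
  have "(\<Sum>j\<le>m. (if j \<le> k then \<xi> j else 0) * (\<delta> ^^ j) f) = (\<Sum>j\<le>k. \<xi> j * (\<delta> ^^ j) f)"
    using assms by (intro sum.mono_neutral_cong_right) auto
  thus "diff_op \<delta> k \<xi> f = diff_op \<delta> m (\<lambda>j. if j \<le> k then \<xi> j else 0) f"
    by (simp add: diff_op_def)
qed

lemma Diff_plus: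
  assumes "P \<in> Diff \<delta>" "Q \<in> Diff \<delta>" shows "(\<lambda>f. P f + Q f) \<in> Diff \<delta>"
proof -
  from assms obtain k \<xi> m \<eta> where "P = diff_op \<delta> k \<xi>" "Q = diff_op \<delta> m \<eta>"
    by (auto simp: Diff_def)
  then obtain \<xi>' \<eta>' where P: "P = diff_op \<delta> (max k m) \<xi>'" and Q: "Q = diff_op \<delta> (max k m) \<eta>'"
    using diff_op_pad[of k "max k m"] diff_op_pad[of m "max k m"] by (meson max.cobounded1 max.cobounded2)
  have "(\<lambda>f. P f + Q f) = diff_op \<delta> (max k m) (\<lambda>j. \<xi>' j + \<eta>' j)"
    unfolding P Q by (simp add: diff_op_def distrib_right sum.distrib)
  thus ?thesis by (auto simp: Diff_def)
qed

lemma Diff_mult: assumes "P \<in> Diff \<delta>" shows "(\<lambda>f. g * P f) \<in> Diff \<delta>"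
proof -
  from assms obtain k \<xi> where P: "P = diff_op \<delta> k \<xi>" by (auto simp: Diff_def)
  have "(\<lambda>f. g * P f) = diff_op \<delta> k (\<lambda>j. g * \<xi> j)"
    unfolding P by (simp add: diff_op_def sum_distrib_left mult.assoc)
  thus ?thesis by (auto simp: Diff_def)
qed

lemma Diff_id: "(\<lambda>f. f) \<in> Diff \<delta>"
proof -
  have "(\<lambda>f. f) = diff_op \<delta> 0 (\<lambda>_. 1)" by (simp add: diff_op_def)
  thus ?thesis by (auto simp: Diff_def)
qed

lemma Diff_sum:
  assumes "finite A" "\<And>i. i \<in> A \<Longrightarrow> P i \<in> Diff \<delta>"
  shows "(\<lambda>f. \<Sum>i\<in>A. P i f) \<in> Diff \<delta>"
  using assms
proof (induction A rule: finite_induct)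
  case empty
  show ?case using Diff_mult[OF Diff_id, of 0] by simp
next
  case (insert i A)
  thus ?case using Diff_plus[of "P i" "\<lambda>f. \<Sum>i\<in>A. P i f"] by simp
qed

lemma Diff_funpow: "(\<lambda>f. (\<delta> ^^ j) f) \<in> Diff \<delta>"
proof -
  have "(\<lambda>f. (\<delta> ^^ j) f) = diff_op \<delta> j (\<lambda>i. if i = j then 1 else 0)"
  proof
    fix f
    have "(\<Sum>i\<le>j. (if i = j then 1 else 0) * (\<delta> ^^ i) f) = (\<Sum>i\<in>{j}. 1 * (\<delta> ^^ i) f)"
      by (intro sum.mono_neutral_cong_right) auto
    thus "(\<delta> ^^ j) f = diff_op \<delta> j (\<lambda>i. if i = j then 1 else 0) f"
      by (simp add: diff_op_def)
  qed
  thus ?thesis by (auto simp: Diff_def)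
qed

lemma Diff_\<delta>: assumes "P \<in> Diff \<delta>" shows "(\<lambda>f. \<delta> (P f)) \<in> Diff \<delta>"
proof -
  from assms obtain k \<xi> where P: "P = diff_op \<delta> k \<xi>" by (auto simp: Diff_def)
  have "(\<lambda>f. \<delta> (P f)) = (\<lambda>f. \<Sum>j\<le>k. \<delta> (\<xi> j) * (\<delta> ^^ j) f + \<xi> j * (\<delta> ^^ Suc j) f)"
    unfolding P by (simp add: diff_op_def \<delta>_sum \<delta>_mult)
  also have "\<dots> \<in> Diff \<delta>"
    by (intro Diff_sum Diff_plus Diff_mult Diff_funpow) simp
  finally show ?thesis .
qed

lemma Diff_funpow_comp: assumes "P \<in> Diff \<delta>" shows "(\<lambda>f. (\<delta> ^^ j) (P f)) \<in> Diff \<delta>"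
  by (induction j) (simp_all add: assms Diff_\<delta>)

lemma Diff_comp: assumes "P \<in> Diff \<delta>" "Q \<in> Diff \<delta>" shows "P \<circ> Q \<in> Diff \<delta>"
proof -
  from assms(1) obtain k \<xi> where P: "P = diff_op \<delta> k \<xi>" by (auto simp: Diff_def)
  have "P \<circ> Q = (\<lambda>f. \<Sum>j\<le>k. \<xi> j * (\<delta> ^^ j) (Q f))"
    unfolding P by (auto simp: diff_op_def)
  also have "\<dots> \<in> Diff \<delta>"
    by (intro Diff_sum Diff_mult Diff_funpow_comp assms) simp
  finally show ?thesis .
qed

lemma Diff_commutator:
  assumes "P \<in> Diff \<delta>" "Q \<in> Diff \<delta>" shows "op_commutator P Q \<in> Diff \<delta>"
  using Diff_plus[OF Diff_comp[OF assms] Diff_mult[OF Diff_comp[OF assms(2,1)], of "-1"]]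
  by (simp add: op_commutator_def o_def)

lemma \<delta>_z_power: "\<delta> (z ^ Suc n) = of_nat (Suc n) * z ^ n"
  by (induction n) (simp_all add: \<delta>_mult \<delta>_z algebra_simps)

lemma funpow_\<delta>_z_power: "(\<delta> ^^ j) (z ^ j) = of_nat (fact j)"
proof (induction j)
  case (Suc j)
  have "(\<delta> ^^ Suc j) (z ^ Suc j) = (\<delta> ^^ j) (\<kappa> (of_nat (Suc j)) * z ^ j)"
    unfolding funpow_Suc_right o_apply \<delta>_z_power \<kappa>_of_nat ..
  also have "\<dots> = \<kappa> (of_nat (Suc j)) * of_nat (fact j)"
    by (simp only: funpow_\<delta>_scale Suc.IH)
  also have "\<dots> = of_nat (fact (Suc j))"
    by (simp only: \<kappa>_of_nat fact_Suc of_nat_mult of_nat_id)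
  finally show ?case .
qed simp

lemma funpow_\<delta>_z_power_0: assumes "j < i" shows "(\<delta> ^^ i) (z ^ j) = 0"
proof -
  have "(\<delta> ^^ Suc n) (z ^ j) = 0" if "j \<le> n" for n
    using that
  proof (induction n rule: dec_induct)
    case base
    show ?case by (simp add: funpow_\<delta>_z_power) (metis \<delta>_\<kappa> \<kappa>_of_nat of_nat_fact)
  next
    case (step n)
    thus ?case by (simp add: \<delta>_0)
  qed
  from this[of "i - 1"] assms show ?thesis by simp
qed

text \<open>The coefficients, and hence the order, of a differential operator are determined by
  its action on \<open>V\<close>.\<close>

lemma diff_op_coeffs_unique:
  assumes "diff_op \<delta> k \<xi> = diff_op \<delta> k \<eta>" "j \<le> k"
  shows "\<xi> j = \<eta> j"
  using assms(2)
proof (induction j rule: less_induct)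
  case (less j)
  let ?d = "\<lambda>i. \<xi> i - \<eta> i"
  have "(\<Sum>i\<le>k. ?d i * (\<delta> ^^ i) (z ^ j)) = 0"
    using fun_cong[OF assms(1), of "z ^ j"] by (simp add: diff_op_def left_diff_distrib sum_subtractf)
  also have "(\<Sum>i\<le>k. ?d i * (\<delta> ^^ i) (z ^ j)) = (\<Sum>i\<in>{j}. ?d i * (\<delta> ^^ i) (z ^ j))"
  proof (rule sum.mono_neutral_cong_right)
    show "\<forall>i\<in>{..k} - {j}. ?d i * (\<delta> ^^ i) (z ^ j) = 0"
    proof
      fix i assume i: "i \<in> {..k} - {j}"
      show "?d i * (\<delta> ^^ i) (z ^ j) = 0"
        using i less.IH[of i] less.prems funpow_\<delta>_z_power_0[of j i] by (cases "i < j") auto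
    qed
  qed (use less.prems in auto)
  finally have "?d j * of_nat (fact j) = 0"
    by (simp add: funpow_\<delta>_z_power)
  thus ?case
    unfolding mult_eq_0_iff of_nat_eq_0_iff' by simp
qed

lemma has_order_unique:
  assumes "has_order \<delta> P k" "has_order \<delta> P m" shows "k = m"
proof -
  have *: "\<not> k < m" if "has_order \<delta> P k" "has_order \<delta> P m" for k m
  proof
    assume "k < m"
    from that obtain \<xi> \<eta> where "P = diff_op \<delta> k \<xi>" "P = diff_op \<delta> m \<eta>" "\<eta> m \<noteq> 0"
      unfolding has_order_def by blast
    with diff_op_coeffs_unique[of m "\<lambda>j. if j \<le> k then \<xi> j else 0" \<eta> m] diff_op_pad[of k m \<xi>] \<open>k < m\<close>
    show False by auto
  qed
  from *[OF assms] *[OF assms(2,1)] show ?thesis by simp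
qed

primrec uterm_eval :: "(sl2 \<Rightarrow> 'v \<Rightarrow> 'v) \<Rightarrow> uterm \<Rightarrow> 'v \<Rightarrow> 'v" where
  "uterm_eval \<rho> (UConst c) = (\<lambda>f. \<kappa> c * f)"
| "uterm_eval \<rho> (UGen x) = \<rho> x"
| "uterm_eval \<rho> (UAdd a b) = (\<lambda>f. uterm_eval \<rho> a f + uterm_eval \<rho> b f)"
| "uterm_eval \<rho> (UMul a b) = uterm_eval \<rho> a \<circ> uterm_eval \<rho> b"

context
  fixes \<rho> assumes \<rho>: "\<rho> \<in> lie_homs \<kappa> \<delta>"
begin

lemma uterm_eval_Diff: "uterm_eval \<rho> a \<in> Diff \<delta>"
proof (induction a)
  case (UConst c)
  show ?case using Diff_mult[OF Diff_id, of "\<kappa> c"] by simp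
next
  case (UGen x)
  show ?case using \<rho> by (simp add: lie_homs_def)
qed (simp_all add: Diff_plus Diff_comp Diff_comp[unfolded o_def])

lemma uterm_eval_ueq: "ueq a b \<Longrightarrow> uterm_eval \<rho> a = uterm_eval \<rho> b"
proof (induction rule: ueq.induct)
  case (ueq_gen_bracket x y)
  have "\<rho> (sl2_bracket x y) = op_commutator (\<rho> x) (\<rho> y)"
    using \<rho> by (simp add: lie_homs_def)
  thus ?case by (simp add: op_commutator_def fun_eq_iff)
next
  case (ueq_const_central s a)
  show ?case by (simp add: fun_eq_iff Diff_scale[OF uterm_eval_Diff])
qed (use \<rho> in \<open>simp_all add: fun_eq_iff lie_homs_def algebra_simps \<kappa>_0 \<kappa>_1 \<kappa>_uminus \<kappa>_add \<kappa>_mult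
       Diff_add[OF uterm_eval_Diff] Diff_scale[OF uterm_eval_Diff]\<close>)

lemma ex1_alg_hom: "\<exists>!\<Phi>. \<Phi> \<in> alg_homs \<kappa> \<delta> \<and> (\<forall>x. \<Phi> (u_incl x) = \<rho> x)"
proof (rule ex1I)
  define \<Phi> where "\<Phi> u = uterm_eval \<rho> (rep_usl2 u)" for u
  have \<Phi>: "\<Phi> (abs_usl2 a) = uterm_eval \<rho> a" for a
    unfolding \<Phi>_def using uterm_eval_ueq[OF Quotient3_rep_abs[OF Quotient3_usl2 ueq_refl]] by simp
  have ex: "\<exists>a. u = abs_usl2 a" for u
    by (metis Quotient3_abs_rep[OF Quotient3_usl2])
  show "\<Phi> \<in> alg_homs \<kappa> \<delta> \<and> (\<forall>x. \<Phi> (u_incl x) = \<rho> x)"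
    unfolding alg_homs_def mem_Collect_eq
  proof (intro conjI allI)
    fix u v c x
    obtain a b where ab: "u = abs_usl2 a" "v = abs_usl2 b" using ex by meson
    show "\<Phi> u \<in> Diff \<delta>" by (simp add: \<Phi>_def uterm_eval_Diff)
    show "\<Phi> (u + v) = (\<lambda>f. \<Phi> u f + \<Phi> v f)" by (simp add: ab plus_usl2.abs_eq \<Phi>)
    show "\<Phi> (u * v) = \<Phi> u \<circ> \<Phi> v" by (simp add: ab times_usl2.abs_eq \<Phi>)
    show "\<Phi> (u_scalar c * u) = (\<lambda>f. \<kappa> c * \<Phi> u f)"
      by (simp add: ab u_scalar.abs_eq times_usl2.abs_eq \<Phi> o_def)
    show "\<Phi> 1 = id" by (simp add: one_usl2.abs_eq \<Phi> \<kappa>_1 id_def)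
    show "\<Phi> (u_incl x) = \<rho> x" by (simp add: u_incl.abs_eq \<Phi>)
  qed
  fix \<Psi> assume \<Psi>: "\<Psi> \<in> alg_homs \<kappa> \<delta> \<and> (\<forall>x. \<Psi> (u_incl x) = \<rho> x)"
  have "\<Psi> (abs_usl2 a) = uterm_eval \<rho> a" for a
  proof (induction a)
    case (UConst c)
    have "\<Psi> (u_scalar c * 1) = (\<lambda>f. \<kappa> c * \<Psi> 1 f)" and "\<Psi> 1 = id"
      using \<Psi> unfolding alg_homs_def by blast+
    thus ?case by (simp add: u_scalar.abs_eq)
  next
    case (UGen x)
    thus ?case using \<Psi> by (simp flip: u_incl.abs_eq)
  next
    case (UAdd a b)
    thus ?case using \<Psi> by (simp add: alg_homs_def flip: plus_usl2.abs_eq)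
  next
    case (UMul a b)
    thus ?case using \<Psi> by (simp add: alg_homs_def flip: times_usl2.abs_eq)
  qed
  thus "\<Psi> = \<Phi>" using \<Phi> ex by (metis ext)
qed

lemma induced_hom_alg_hom: "induced_hom \<kappa> \<delta> \<rho> \<in> alg_homs \<kappa> \<delta>"
  and induced_hom_incl: "induced_hom \<kappa> \<delta> \<rho> (u_incl x) = \<rho> x"
  using theI'[OF ex1_alg_hom] by (simp_all add: induced_hom_def)

end

end


section \<open>The fields \<open>C(z)\<close> and \<open>C((z))\<close>\<close>

definition ratfun_const :: "complex \<Rightarrow> complex poly fract" where
  "ratfun_const c = Fract [:c:] 1"

definition ratfun_deriv :: "complex poly fract \<Rightarrow> complex poly fract" where
  "ratfun_deriv q =
     (THE r. \<exists>a b. b \<noteq> 0 \<and> q = Fract a b \<and> r = Fract (pderiv a * b - a * pderiv b) (b * b))"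

lemma ratfun_deriv_Fract:
  assumes "b \<noteq> 0"
  shows "ratfun_deriv (Fract a b) = Fract (pderiv a * b - a * pderiv b) (b * b)"
  unfolding ratfun_deriv_def
proof (rule the_equality)
  fix r assume "\<exists>c d. d \<noteq> 0 \<and> Fract a b = Fract c d \<and> r = Fract (pderiv c * d - c * pderiv d) (d * d)"
  then obtain c d where d: "d \<noteq> 0" and cd: "Fract a b = Fract c d"
    and r: "r = Fract (pderiv c * d - c * pderiv d) (d * d)" by blast
  have eq: "a * d = c * b" using assms d cd by (simp add: eq_fract)
  hence "pderiv (a * d) = pderiv (c * b)" by simp
  hence *: "a * pderiv d + d * pderiv a = c * pderiv b + b * pderiv c"
    by (simp add: pderiv_mult)
  have "(pderiv a * b - a * pderiv b) * (d * d) - (pderiv c * d - c * pderiv d) * (b * b)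
      = (a * pderiv d + d * pderiv a - (c * pderiv b + b * pderiv c)) * (b * d)
        - (a * d - c * b) * (b * pderiv d + d * pderiv b)"
    by (simp add: algebra_simps)
  also have "\<dots> = 0" using * eq by simp
  finally have "(pderiv a * b - a * pderiv b) * (d * d) = (pderiv c * d - c * pderiv d) * (b * b)"
    by simp
  thus "r = Fract (pderiv a * b - a * pderiv b) (b * b)"
    using assms d by (simp add: r eq_fract)
qed (use assms in blast)

lemma differential_field_ratfun: "differential_field ratfun_const ratfun_deriv (Fract [:0, 1:] 1)"
proof
  fix f g :: "complex poly fract"
  obtain a b c d where f: "f = Fract a b" "b \<noteq> 0" and g: "g = Fract c d" "d \<noteq> 0"
    by (cases f, cases g)
  have bd: "b * d \<noteq> 0" "b * b \<noteq> 0" "d * d \<noteq> 0" using f g by auto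
  have "(pderiv (a * d + c * b) * (b * d) - (a * d + c * b) * pderiv (b * d)) * (b * b * (d * d))
      = ((pderiv a * b - a * pderiv b) * (d * d) + (pderiv c * d - c * pderiv d) * (b * b))
        * (b * d * (b * d))"
    unfolding pderiv_mult pderiv_add by (simp only: algebra_simps)
  thus "ratfun_deriv (f + g) = ratfun_deriv f + ratfun_deriv g"
    unfolding f(1) g(1) using f(2) g(2) bd
    by (simp only: add_fract ratfun_deriv_Fract eq_fract no_zero_divisors not_False_eq_True)
  have "(pderiv (a * c) * (b * d) - a * c * pderiv (b * d)) * (b * b * d * (b * (d * d)))
      = ((pderiv a * b - a * pderiv b) * c * (b * (d * d)) +
         a * (pderiv c * d - c * pderiv d) * (b * b * d)) * (b * d * (b * d))"
    unfolding pderiv_mult by (simp only: algebra_simps)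
  thus "ratfun_deriv (f * g) = ratfun_deriv f * g + f * ratfun_deriv g"
    unfolding f(1) g(1) using f(2) g(2) bd
    by (simp only: add_fract mult_fract ratfun_deriv_Fract eq_fract no_zero_divisors not_False_eq_True)
  fix a b :: complex
  show "ratfun_const (a + b) = ratfun_const a + ratfun_const b"
    and "ratfun_const (a * b) = ratfun_const a * ratfun_const b"
    by (simp_all add: ratfun_const_def mult.commute)
  show "ratfun_const 1 = 1"
    by (simp add: ratfun_const_def One_fract_def pCons_one)
  show "ratfun_deriv (ratfun_const a) = 0"
    by (simp add: ratfun_const_def ratfun_deriv_Fract Zero_fract_def pderiv_pCons)
  show "ratfun_deriv (Fract [:0, 1:] 1) = 1"
    by (simp add: ratfun_deriv_Fract One_fract_def pderiv_pCons pCons_one)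
qed

lemma differential_field_fls:
  "differential_field (fls_const :: complex \<Rightarrow> complex fls) fls_deriv fls_X"
proof
  fix a b :: complex and f g :: "complex fls"
  show "fls_const (a + b) = fls_const a + fls_const b" by (simp add: fls_plus_const)
  show "fls_const (a * b) = fls_const a * fls_const b" by simp
  show "fls_const (1 :: complex) = 1" by simp
  show "fls_deriv (f + g) = fls_deriv f + fls_deriv g" by (rule fls_deriv_add)
  show "fls_deriv (f * g) = fls_deriv f * g + f * fls_deriv g"
    by (simp only: fls_deriv_mult add.commute)
  show "fls_deriv (fls_const a) = 0" by (rule fls_deriv_const)
  show "fls_deriv (fls_X :: complex fls) = 1" by (rule fls_deriv_X)
qed

end

theory Submission
  imports Defs "HOL-Computational_Algebra.Field_as_Ring"
begin

text \<open>
  The image \<open>Q\<close> of the Casimir element is a differential operator that commutes with \<open>\<rho>(L\<^sub>0)\<close> and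
  \<open>\<rho>(L\<^sub>1)\<close>. A comparison of leading symbols shows that every differential operator with this property
  is multiplication by a constant, so \<open>Q\<close> never has to be computed.

  The commutator of \<open>\<xi>\<partial>\<^sup>m + \<dots>\<close> with \<open>\<eta>\<partial>\<^sup>n + \<dots>\<close> has, modulo operators of order below \<open>m + n - 1\<close>, the
  single term of order \<open>m + n - 1\<close> with coefficient \<open>m\<xi>\<eta>' - n\<eta>\<xi>'\<close> (lemma \<open>commutator_symbol\<close>). Write
  \<open>\<rho>(L\<^sub>0) = h\<partial> + \<dots>\<close>, \<open>\<rho>(L\<^sub>1) = a\<partial>\<^sup>m + \<dots>\<close> and \<open>Q = q\<partial>\<^sup>k + \<dots>\<close> with \<open>h\<close>, \<open>a\<close>, \<open>q\<close> nonzero; here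
  \<open>\<rho>(L\<^sub>1)\<close> is nonzero because its commutator with \<open>\<rho>(L\<^sub>-\<^sub>1)\<close> is \<open>2\<rho>(L\<^sub>0)\<close>. From
  \<open>[L\<^sub>0, L\<^sub>1] = -L\<^sub>1\<close> one reads off \<open>ha' = mah' - a\<close>, and since \<open>Q\<close> commutes with \<open>\<rho>(L\<^sub>0)\<close> also
  \<open>hq' = kqh'\<close>. The leading symbol of the vanishing commutator \<open>[Q, \<rho>(L\<^sub>1)]\<close>, multiplied by \<open>h\<close>, is then
    \<open>h(kqa' - maq') = kq(mah' - a) - ma(kqh') = -kqa\<close>,
  so \<open>k = 0\<close> (lemma \<open>commutant_order_zero\<close>). Thus \<open>Q\<close> is multiplication by \<open>q\<close>, and \<open>hq' = 0\<close> makes \<open>q\<close> a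
  constant of the differential field. In both \<open>C(z)\<close> and \<open>C((z))\<close> the constants are the complex numbers.
\<close>


section \<open>The filtration by order\<close>

text \<open>A strict bound instead of "order at most \<open>n\<close>" makes the zero operator the only operator of the
  lowest level \<open>n = 0\<close>, so that error terms need no separate treatment when they vanish.\<close>

definition order_below :: "('v::field \<Rightarrow> 'v) \<Rightarrow> nat \<Rightarrow> ('v \<Rightarrow> 'v) \<Rightarrow> bool" where
  "order_below \<delta> n P \<longleftrightarrow> (\<exists>\<xi>. P = (\<lambda>f. \<Sum>j<n. \<xi> j * (\<delta> ^^ j) f))"

context differential_field
begin

lemma order_below_zero: "order_below \<delta> n (\<lambda>f. 0)"
  unfolding order_below_def by (rule exI[of _ "\<lambda>_. 0"]) simp

lemma order_below_monom: "j < n \<Longrightarrow> order_below \<delta> n (\<lambda>f. c * (\<delta> ^^ j) f)"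
  unfolding order_below_def
  by (rule exI[of _ "\<lambda>i. if i = j then c else 0"]) (simp add: if_distrib[of "\<lambda>x. x * _"] cong: if_cong)

lemma order_below_add:
  assumes "order_below \<delta> n P" "order_below \<delta> n Q"
  shows "order_below \<delta> n (\<lambda>f. P f + Q f)"
proof -
  from assms obtain \<xi> \<eta> where "P = (\<lambda>f. \<Sum>j<n. \<xi> j * (\<delta> ^^ j) f)" "Q = (\<lambda>f. \<Sum>j<n. \<eta> j * (\<delta> ^^ j) f)"
    by (auto simp: order_below_def)
  thus ?thesis unfolding order_below_def
    by (intro exI[of _ "\<lambda>j. \<xi> j + \<eta> j"]) (simp add: distrib_right sum.distrib)
qed

lemma order_below_mult:
  assumes "order_below \<delta> n P" shows "order_below \<delta> n (\<lambda>f. g * P f)"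
proof -
  from assms obtain \<xi> where "P = (\<lambda>f. \<Sum>j<n. \<xi> j * (\<delta> ^^ j) f)"
    by (auto simp: order_below_def)
  thus ?thesis unfolding order_below_def
    by (intro exI[of _ "\<lambda>j. g * \<xi> j"]) (simp add: sum_distrib_left mult.assoc)
qed

lemma order_below_diff:
  assumes "order_below \<delta> n P" "order_below \<delta> n Q"
  shows "order_below \<delta> n (\<lambda>f. P f - Q f)"
  using order_below_add[OF assms(1) order_below_mult[OF assms(2), of "-1"]] by simp

lemma order_below_sum:
  assumes "\<And>i. i \<in> A \<Longrightarrow> order_below \<delta> n (P i)"
  shows "order_below \<delta> n (\<lambda>f. \<Sum>i\<in>A. P i f)"
  using assms
  by (induction A rule: infinite_finite_induct) (simp_all add: order_below_zero order_below_add)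

lemma order_below_mono:
  assumes "order_below \<delta> m P" "m \<le> n" shows "order_below \<delta> n P"
proof -
  from assms obtain \<xi> where P: "P = (\<lambda>f. \<Sum>j<m. \<xi> j * (\<delta> ^^ j) f)"
    by (auto simp: order_below_def)
  show ?thesis unfolding P
    by (intro order_below_sum order_below_monom) (use assms(2) in auto)
qed

lemma order_below_derivative_comp:
  assumes "order_below \<delta> n P" shows "order_below \<delta> (Suc n) (\<lambda>f. \<delta> (P f))"
proof -
  from assms obtain \<xi> where P: "P = (\<lambda>f. \<Sum>j<n. \<xi> j * (\<delta> ^^ j) f)"
    by (auto simp: order_below_def)
  have eq: "(\<lambda>f. \<delta> (P f)) = (\<lambda>f. \<Sum>j<n. \<delta> (\<xi> j) * (\<delta> ^^ j) f + \<xi> j * (\<delta> ^^ Suc j) f)"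
    unfolding P by (simp add: \<delta>_sum \<delta>_mult)
  show ?thesis unfolding eq
    by (intro order_below_sum order_below_add order_below_monom) auto
qed

lemma order_below_comp_derivative:
  assumes "order_below \<delta> n P" shows "order_below \<delta> (n + k) (\<lambda>f. P ((\<delta> ^^ k) f))"
proof -
  from assms obtain \<xi> where P: "P = (\<lambda>f. \<Sum>j<n. \<xi> j * (\<delta> ^^ j) f)"
    by (auto simp: order_below_def)
  have eq: "(\<lambda>f. P ((\<delta> ^^ k) f)) = (\<lambda>f. \<Sum>j<n. \<xi> j * (\<delta> ^^ (j + k)) f)"
    unfolding P by (simp add: funpow_add)
  show ?thesis unfolding eq
    by (intro order_below_sum order_below_monom) auto
qed

lemma diff_op_minus_leading_term:
  "order_below \<delta> k (\<lambda>f. diff_op \<delta> k \<xi> f - \<xi> k * (\<delta> ^^ k) f)"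
proof -
  have "diff_op \<delta> k \<xi> f - \<xi> k * (\<delta> ^^ k) f = (\<Sum>j<k. \<xi> j * (\<delta> ^^ j) f)" for f
    by (simp add: diff_op_def flip: lessThan_Suc_atMost)
  thus ?thesis unfolding order_below_def by auto
qed

text \<open>This is what makes a comparison of leading symbols legitimate: a coefficient of \<open>\<partial>\<^sup>k\<close> that can be
  absorbed by lower order terms vanishes, as the coefficients of a differential operator are determined
  by its action.\<close>

lemma leading_coeff_zero:
  assumes "order_below \<delta> k (\<lambda>f. c * (\<delta> ^^ k) f)" shows "c = 0"
proof -
  from assms obtain \<xi> where \<xi>: "\<And>f. c * (\<delta> ^^ k) f = (\<Sum>j<k. \<xi> j * (\<delta> ^^ j) f)"
    unfolding order_below_def fun_eq_iff by blast
  let ?c = "\<lambda>j. if j = k then c else 0" and ?x = "\<lambda>j. if j < k then \<xi> j else 0"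
  have "diff_op \<delta> k ?c = diff_op \<delta> k ?x"
  proof
    fix f
    have "diff_op \<delta> k ?c f = c * (\<delta> ^^ k) f"
      by (simp add: diff_op_def flip: lessThan_Suc_atMost)
    also have "\<dots> = diff_op \<delta> k ?x f"
      unfolding \<xi> by (simp add: diff_op_def flip: lessThan_Suc_atMost)
    finally show "diff_op \<delta> k ?c f = diff_op \<delta> k ?x f" .
  qed
  from diff_op_coeffs_unique[OF this, of k] show ?thesis by simp
qed

lemma nonzero_has_order:
  assumes "P \<in> Diff \<delta>" "P \<noteq> (\<lambda>f. 0)" shows "\<exists>k. has_order \<delta> P k"
proof -
  have "\<exists>k. has_order \<delta> P k" if "P = diff_op \<delta> k \<xi>" for k \<xi>
    using that
  proof (induction k arbitrary: \<xi>)
    case 0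
    hence "\<xi> 0 \<noteq> 0" using assms(2) by (auto simp: diff_op_def)
    thus ?case using 0 unfolding has_order_def by blast
  next
    case (Suc k)
    show ?case
    proof (cases "\<xi> (Suc k) = 0")
      case True
      hence "P = diff_op \<delta> k \<xi>" using Suc.prems by (simp add: diff_op_def)
      thus ?thesis by (rule Suc.IH)
    next
      case False
      thus ?thesis using Suc.prems unfolding has_order_def by blast
    qed
  qed
  thus ?thesis using assms(1) by (auto simp: Diff_def)
qed


section \<open>The leading symbol of a commutator\<close>

text \<open>Only the first two terms of Leibniz' rule for \<open>\<partial>\<^sup>n(bf)\<close> matter for the symbol of a commutator, so the
  rest is kept as an unspecified lower order operator, which one further derivative raises by one
  order. For \<open>n = 0\<close> the truncated exponent \<open>n - 1\<close> is harmless because the coefficient \<open>n\<close> vanishes.\<close>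

lemma leibniz_mod_lower_order:
  "order_below \<delta> (n - 1)
     (\<lambda>f. (\<delta> ^^ n) (b * f) - (b * (\<delta> ^^ n) f + of_nat n * \<delta> b * (\<delta> ^^ (n - 1)) f))"
proof (induction n)
  case 0
  show ?case by (simp add: order_below_zero)
next
  case (Suc n)
  define R where
    "R f = (\<delta> ^^ n) (b * f) - (b * (\<delta> ^^ n) f + of_nat n * \<delta> b * (\<delta> ^^ (n - 1)) f)" for f
  have R: "order_below \<delta> (n - 1) R" using Suc.IH by (simp add: R_def[abs_def])
  have of_nat: "\<delta> (of_nat n) = 0" by (metis \<kappa>_of_nat \<delta>_\<kappa>)
  have "(\<delta> ^^ Suc n) (b * f) - (b * (\<delta> ^^ Suc n) f + of_nat (Suc n) * \<delta> b * (\<delta> ^^ n) f)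
      = of_nat n * \<delta> (\<delta> b) * (\<delta> ^^ (n - 1)) f + \<delta> (R f)" for f
  proof (cases n)
    case 0
    thus ?thesis using R by (simp add: \<delta>_mult order_below_def \<delta>_0)
  next
    case (Suc k)
    have "(\<delta> ^^ n) (b * f) = b * (\<delta> ^^ n) f + of_nat n * \<delta> b * (\<delta> ^^ (n - 1)) f + R f"
      by (simp add: R_def)
    hence "(\<delta> ^^ Suc n) (b * f)
        = \<delta> (b * (\<delta> ^^ n) f + of_nat n * \<delta> b * (\<delta> ^^ (n - 1)) f + R f)"
      by simp
    moreover have "\<delta> ((\<delta> ^^ (n - 1)) f) = (\<delta> ^^ n) f" using Suc by simp
    ultimately show ?thesis by (simp add: \<delta>_add \<delta>_mult of_nat algebra_simps)
  qed
  moreover have "order_below \<delta> n (\<lambda>f. of_nat n * \<delta> (\<delta> b) * (\<delta> ^^ (n - 1)) f + \<delta> (R f))"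
  proof (cases n)
    case 0
    thus ?thesis using R by (simp add: order_below_def \<delta>_0)
  next
    case (Suc k)
    thus ?thesis using order_below_derivative_comp[OF R]
      by (intro order_below_add order_below_monom) auto
  qed
  ultimately show ?case by simp
qed

lemma monom_comp_mod_lower_order:
  "order_below \<delta> (m + n - 1)
     (\<lambda>f. a * (\<delta> ^^ m) (b * (\<delta> ^^ n) f)
          - (a * b * (\<delta> ^^ (m + n)) f + of_nat m * a * \<delta> b * (\<delta> ^^ (m + n - 1)) f))"
proof (cases m)
  case 0
  thus ?thesis by (simp add: order_below_zero mult.assoc)
next
  case (Suc k)
  note * = order_below_mult[OF order_below_comp_derivative[OF leibniz_mod_lower_order[of m b], of n], of a]
  have eq: "(\<delta> ^^ (m + n)) f = (\<delta> ^^ m) ((\<delta> ^^ n) f)"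
    "(\<delta> ^^ (m + n - 1)) f = (\<delta> ^^ (m - 1)) ((\<delta> ^^ n) f)" for f
    using Suc by (simp_all add: funpow_add)
  have "m - 1 + n = m + n - 1" using Suc by simp
  with * show ?thesis unfolding eq by (simp only: algebra_simps)
qed

text \<open>The terms of order \<open>m + n\<close> cancel because the coefficients commute.\<close>

lemma commutator_monom_symbol:
  "order_below \<delta> (m + n - 1)
     (\<lambda>f. a * (\<delta> ^^ m) (b * (\<delta> ^^ n) f) - b * (\<delta> ^^ n) (a * (\<delta> ^^ m) f)
          - (of_nat m * a * \<delta> b - of_nat n * b * \<delta> a) * (\<delta> ^^ (m + n - 1)) f)"
proof -
  let ?M = "\<lambda>m n a b f. a * (\<delta> ^^ m) (b * (\<delta> ^^ n) f)
      - (a * b * (\<delta> ^^ (m + n)) f + of_nat m * a * \<delta> b * (\<delta> ^^ (m + n - 1)) f)"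
  have "order_below \<delta> (m + n - 1) (\<lambda>f. ?M m n a b f - ?M n m b a f)"
    using order_below_diff[OF monom_comp_mod_lower_order[of m n a b] monom_comp_mod_lower_order[of n m b a, unfolded add.commute[of n m]]]
    by (simp only: add.commute[of n m])
  thus ?thesis by (simp add: add.commute[of n m] algebra_simps)
qed

text \<open>By bilinearity the commutator is a sum of commutators of monomials, and among these only the pair of
  leading monomials reaches order \<open>m + n - 1\<close>. The formula is the Poisson bracket of the two principal
  symbols.\<close>

lemma commutator_symbol:
  "order_below \<delta> (m + n - 1)
     (\<lambda>f. op_commutator (diff_op \<delta> m \<xi>) (diff_op \<delta> n \<eta>) f
          - (of_nat m * \<xi> m * \<delta> (\<eta> n) - of_nat n * \<eta> n * \<delta> (\<xi> m)) * (\<delta> ^^ (m + n - 1)) f)"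
proof -
  define B where "B p f = \<xi> (fst p) * (\<delta> ^^ fst p) (\<eta> (snd p) * (\<delta> ^^ snd p) f)
      - \<eta> (snd p) * (\<delta> ^^ snd p) (\<xi> (fst p) * (\<delta> ^^ fst p) f)" for p f
  define s where "s = of_nat m * \<xi> m * \<delta> (\<eta> n) - of_nat n * \<eta> n * \<delta> (\<xi> m)"
  have funpow_sum: "(\<delta> ^^ i) (sum g A) = (\<Sum>x\<in>A. (\<delta> ^^ i) (g x))" for i and g :: "nat \<Rightarrow> 'v" and A
    by (induction i) (simp_all add: \<delta>_sum)
  have "op_commutator (diff_op \<delta> m \<xi>) (diff_op \<delta> n \<eta>) f
      = (\<Sum>i\<le>m. \<Sum>j\<le>n. \<xi> i * (\<delta> ^^ i) (\<eta> j * (\<delta> ^^ j) f))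
        - (\<Sum>j\<le>n. \<Sum>i\<le>m. \<eta> j * (\<delta> ^^ j) (\<xi> i * (\<delta> ^^ i) f))" for f
    by (simp add: op_commutator_def diff_op_def funpow_sum sum_distrib_left)
  also have "\<dots> f = (\<Sum>p\<in>{..m} \<times> {..n}. B p f)" for f
    by (subst (2) sum.swap) (simp add: B_def sum_subtractf sum.cartesian_product case_prod_beta)
  also have "\<dots> f = B (m, n) f + (\<Sum>p\<in>{..m} \<times> {..n} - {(m, n)}. B p f)" for f
    by (rule sum.remove) auto
  finally have eq: "op_commutator (diff_op \<delta> m \<xi>) (diff_op \<delta> n \<eta>) f - s * (\<delta> ^^ (m + n - 1)) f
      = (B (m, n) f - s * (\<delta> ^^ (m + n - 1)) f) + (\<Sum>p\<in>{..m} \<times> {..n} - {(m, n)}. B p f)" for f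
    by simp
  have "order_below \<delta> (m + n - 1) (\<lambda>f. \<Sum>p\<in>{..m} \<times> {..n} - {(m, n)}. B p f)"
  proof (rule order_below_sum)
    fix p assume p: "p \<in> {..m} \<times> {..n} - {(m, n)}"
    obtain i j where ij: "p = (i, j)" by (cases p)
    define c where "c = of_nat i * \<xi> i * \<delta> (\<eta> j) - of_nat j * \<eta> j * \<delta> (\<xi> i)"
    have less: "i + j < m + n" using p ij by auto
    have "order_below \<delta> (m + n - 1) (\<lambda>f. B p f - c * (\<delta> ^^ (i + j - 1)) f)"
      using commutator_monom_symbol[of i j "\<xi> i" "\<eta> j"] less
      by (auto simp: B_def ij c_def intro: order_below_mono)
    moreover have "order_below \<delta> (m + n - 1) (\<lambda>f. c * (\<delta> ^^ (i + j - 1)) f)"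
    proof (cases "i + j = 0")
      \<comment> \<open>Two multiplication operators commute; here \<open>i + j - 1\<close> is truncated, but \<open>c = 0\<close>.\<close>
      case True
      thus ?thesis by (simp add: c_def order_below_zero)
    next
      case False
      thus ?thesis using less by (intro order_below_monom) auto
    qed
    ultimately show "order_below \<delta> (m + n - 1) (B p)"
      using order_below_add by fastforce
  qed
  moreover have "order_below \<delta> (m + n - 1) (\<lambda>f. B (m, n) f - s * (\<delta> ^^ (m + n - 1)) f)"
    using commutator_monom_symbol[of m n "\<xi> m" "\<eta> n"] by (simp add: B_def s_def)
  ultimately show ?thesis
    unfolding s_def[symmetric] eq by (intro order_below_add)
qed


section \<open>Operators that commute with a representation\<close>

text \<open>Bracketing with a first-order operator does not raise the order, so an eigenvalue equation for an
  operator gives a first-order differential equation for its leading coefficient.\<close>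

lemma eigenoperator_symbol:
  assumes "op_commutator (diff_op \<delta> 1 \<theta>) (diff_op \<delta> k \<xi>) = (\<lambda>f. \<kappa> c * diff_op \<delta> k \<xi> f)"
  shows "\<theta> 1 * \<delta> (\<xi> k) = \<kappa> c * \<xi> k + of_nat k * \<xi> k * \<delta> (\<theta> 1)"
proof -
  let ?s = "\<theta> 1 * \<delta> (\<xi> k) - of_nat k * \<xi> k * \<delta> (\<theta> 1)"
  have "order_below \<delta> k (\<lambda>f. \<kappa> c * diff_op \<delta> k \<xi> f - ?s * (\<delta> ^^ k) f)"
    using commutator_symbol[of 1 k \<theta> \<xi>] assms by simp
  from order_below_diff[OF order_below_mult[OF diff_op_minus_leading_term[of k \<xi>], of "\<kappa> c"] this]
  have "order_below \<delta> k (\<lambda>f. (?s - \<kappa> c * \<xi> k) * (\<delta> ^^ k) f)"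
    by (simp add: algebra_simps)
  from leading_coeff_zero[OF this] show ?thesis by (simp add: algebra_simps)
qed

text \<open>If \<open>h\<close> is the leading coefficient of \<open>L\<close>, then that of \<open>Q\<close> behaves like \<open>h\<^sup>k\<close>, whereas that of \<open>P\<close> behaves
  like \<open>h\<^sup>m\<close> times a factor \<open>e\<close> with \<open>he' = ce\<close>. This factor is not constant because \<open>c \<noteq> 0\<close>, and it
  keeps the symbol of \<open>[Q, P]\<close> from vanishing unless \<open>k = 0\<close>.\<close>

lemma commutant_order_zero:
  assumes L: "has_order \<delta> L 1" and P: "has_order \<delta> P m" and Q: "has_order \<delta> Q k"
    and c: "c \<noteq> 0"
    and LP: "op_commutator L P = (\<lambda>f. \<kappa> c * P f)"
    and LQ: "op_commutator L Q = (\<lambda>f. 0)"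
    and QP: "op_commutator Q P = (\<lambda>f. 0)"
  shows "k = 0"
proof (rule ccontr)
  assume "k \<noteq> 0"
  obtain \<theta> where \<theta>: "L = diff_op \<delta> 1 \<theta>" "\<theta> 1 \<noteq> 0" using L by (auto simp: has_order_def)
  obtain \<xi> where \<xi>: "P = diff_op \<delta> m \<xi>" "\<xi> m \<noteq> 0" using P by (auto simp: has_order_def)
  obtain \<eta> where \<eta>: "Q = diff_op \<delta> k \<eta>" "\<eta> k \<noteq> 0" using Q by (auto simp: has_order_def)
  have p: "\<theta> 1 * \<delta> (\<xi> m) = \<kappa> c * \<xi> m + of_nat m * \<xi> m * \<delta> (\<theta> 1)"
    using eigenoperator_symbol LP \<theta> \<xi> by blast
  have q: "\<theta> 1 * \<delta> (\<eta> k) = of_nat k * \<eta> k * \<delta> (\<theta> 1)"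
    using eigenoperator_symbol[of \<theta> k \<eta> 0] LQ \<theta> \<eta> by (simp add: \<kappa>_0)
  define s where "s = of_nat k * \<eta> k * \<delta> (\<xi> m) - of_nat m * \<xi> m * \<delta> (\<eta> k)"
  have "order_below \<delta> (k + m - 1) (\<lambda>f. - s * (\<delta> ^^ (k + m - 1)) f)"
    using commutator_symbol[of k m \<eta> \<xi>] QP unfolding \<xi>(1) \<eta>(1) s_def[symmetric] by simp
  from leading_coeff_zero[OF this] have "s = 0" by simp
  \<comment> \<open>The factor \<open>\<theta> 1\<close> allows both derivatives to be eliminated; the terms with \<open>\<delta> (\<theta> 1)\<close> cancel.\<close>
  have "\<theta> 1 * s = of_nat k * \<eta> k * (\<theta> 1 * \<delta> (\<xi> m)) - of_nat m * \<xi> m * (\<theta> 1 * \<delta> (\<eta> k))"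
    by (simp add: s_def algebra_simps)
  also have "\<dots> = of_nat k * \<eta> k * \<kappa> c * \<xi> m"
    unfolding p q by (simp add: algebra_simps)
  finally have "of_nat k * \<eta> k * \<kappa> c * \<xi> m = 0" using \<open>s = 0\<close> by simp
  thus False
    using \<open>k \<noteq> 0\<close> \<xi>(2) \<eta>(2) c of_nat_eq_0_iff'[of k] \<kappa>_eq_0_iff[of c] by simp
qed

lemma commutant_constant:
  assumes constants: "\<And>f. \<delta> f = 0 \<Longrightarrow> f \<in> range \<kappa>"
    and L: "has_order \<delta> L 1" and P: "P \<in> Diff \<delta>" "P \<noteq> (\<lambda>f. 0)" and Q: "Q \<in> Diff \<delta>"
    and c: "c \<noteq> 0"
    and LP: "op_commutator L P = (\<lambda>f. \<kappa> c * P f)"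
    and LQ: "op_commutator L Q = (\<lambda>f. 0)"
    and QP: "op_commutator Q P = (\<lambda>f. 0)"
  shows "\<exists>c. Q = (\<lambda>f. \<kappa> c * f)"
proof (cases "Q = (\<lambda>f. 0)")
  case True
  thus ?thesis by (intro exI[of _ 0]) (simp add: \<kappa>_0)
next
  case False
  obtain m where m: "has_order \<delta> P m" using nonzero_has_order[OF P] by blast
  obtain k where k: "has_order \<delta> Q k" using nonzero_has_order[OF Q False] by blast
  have "k = 0" using commutant_order_zero[OF L m k c LP LQ QP] .
  with k obtain \<eta> where \<eta>: "Q = diff_op \<delta> 0 \<eta>" by (auto simp: has_order_def)
  obtain \<theta> where \<theta>: "L = diff_op \<delta> 1 \<theta>" "\<theta> 1 \<noteq> 0" using L by (auto simp: has_order_def)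
  have "\<theta> 1 * \<delta> (\<eta> 0) = 0"
    using eigenoperator_symbol[of \<theta> 0 \<eta> 0] LQ \<theta> \<eta> by (simp add: \<kappa>_0)
  hence "\<eta> 0 \<in> range \<kappa>" using constants \<theta>(2) by simp
  thus ?thesis using \<eta> by (auto simp: diff_op_def)
qed

end


section \<open>The Casimir element\<close>

text \<open>For \<open>L\<^sub>0\<close> this is the fact that \<open>L\<^sub>-\<^sub>1 L\<^sub>1\<close> has weight zero. For \<open>L\<^sub>1\<close> it is the coincidence of
  the two expressions for the Casimir element: moving \<open>L\<^sub>1\<close> across \<open>L\<^sub>0 - 1/2\<close> turns it into
  \<open>L\<^sub>0 + 1/2\<close>, and so turns the first expression into the second.\<close>

lemma casimir_central_L0_L1:
  assumes "i \<in> {0, 1}"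
  shows "casimir * u_incl (sl2_L i) = u_incl (sl2_L i) * casimir"
proof -
  define h a b t where "h = u_incl (sl2_L 0)" and "a = u_incl (sl2_L (-1))"
    and "b = u_incl (sl2_L 1)" and "t = u_scalar (1/2)"
  have t: "t + t = 1" "\<And>u. t * u = u * t"
    unfolding t_def by (simp_all add: u_scalar_commute u_scalar_1 flip: u_scalar_add)
  have "sl2_bracket (sl2_L 0) (sl2_L (-1)) = sl2_L (-1)"
    by (simp add: sl2_bracket_eq sl2_defs)
  hence ha: "h * a = a * h + a"
    using u_incl_bracket[of "sl2_L 0" "sl2_L (-1)"] by (simp add: h_def a_def algebra_simps)
  have "sl2_bracket (sl2_L 1) (sl2_L 0) = sl2_L 1"
    by (simp add: sl2_bracket_eq sl2_defs)
  hence bh: "b * h = h * b + b"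
    using u_incl_bracket[of "sl2_L 1" "sl2_L 0"] by (simp add: h_def b_def algebra_simps)
  have four: "4 * x = x * 4" for x :: usl2
    by (metis mult_of_nat_commute of_nat_numeral)
  have "(a * b) * h = a * (h * b) + a * b"
    by (simp only: mult.assoc bh distrib_left)
  also have "\<dots> = h * (a * b)"
    by (simp only: ha distrib_right flip: mult.assoc)
  finally have ab: "(a * b) * h = h * (a * b)" .
  have "(h - t) * h = h * (h - t)"
    by (simp add: algebra_simps t(2)[of h])
  hence "(h - t)\<^sup>2 * h = h * (h - t)\<^sup>2"
    unfolding power2_eq_square by (metis mult.assoc)
  with ab have "((h - t)\<^sup>2 - a * b) * h = h * ((h - t)\<^sup>2 - a * b)"
    by (simp only: left_diff_distrib right_diff_distrib)
  hence C0: "casimir * h = h * casimir"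
    unfolding casimir_def h_def[symmetric] a_def[symmetric] b_def[symmetric] t_def[symmetric]
    by (metis four mult.assoc)
  have b_shift: "b * (h - t) = (h + t) * b"
  proof -
    have "(t + t) * b = b" by (simp add: t(1))
    hence "b - t * b = t * b"
      unfolding diff_eq_eq distrib_right by (rule sym)
    hence "h * b + b - t * b = h * b + t * b" by (simp only: add_diff_eq[symmetric])
    thus ?thesis by (simp only: right_diff_distrib distrib_right bh t(2)[of b])
  qed
  have "b * ((h - t)\<^sup>2 - a * b) = (b * (h - t)) * (h - t) - b * a * b"
    by (simp only: power2_eq_square right_diff_distrib[of b "_ * _"] mult.assoc)
  also have "\<dots> = (h + t) * (b * (h - t)) - b * a * b"
    by (simp only: mult.assoc b_shift)
  also have "\<dots> = ((h + t)\<^sup>2 - b * a) * b"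
    unfolding b_shift by (simp only: power2_eq_square left_diff_distrib[of _ _ b] mult.assoc)
  finally have "b * (4 * ((h - t)\<^sup>2 - a * b)) = (4 * ((h + t)\<^sup>2 - b * a)) * b"
    by (metis four mult.assoc)
  hence "casimir * b = b * casimir"
    unfolding h_def a_def b_def t_def by (simp only: flip: casimir_def casimir_alt)
  with C0 show ?thesis using assms by (auto simp: h_def b_def)
qed


section \<open>The fields of constants\<close>

text \<open>If a fraction \<open>a/b\<close> in lowest terms has derivative zero, then \<open>a'b = ab'\<close>, so by coprimality \<open>b\<close> divides
  \<open>b'\<close> and \<open>a\<close> divides \<open>a'\<close>. For degree reasons both polynomials are constant.\<close>

lemma ratfun_deriv_eq_0:
  assumes "ratfun_deriv q = 0" shows "q \<in> range ratfun_const"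
proof -
  obtain a b where q: "q = Fract a b" and b: "b \<noteq> 0" and coprime: "coprime a b"
    using Fract_quot_of_fract[of q] coprime_quot_of_fract[of q] snd_quot_of_fract_nonzero[of q]
    by metis
  have "Fract (pderiv a * b - a * pderiv b) (b * b) = 0"
    using assms b by (simp add: q ratfun_deriv_Fract)
  hence eq: "pderiv a * b = a * pderiv b"
    using b by (simp add: Zero_fract_def eq_fract)
  have "b dvd pderiv b"
    using coprime eq by (metis coprime_commute coprime_dvd_mult_right_iff dvd_triv_right)
  moreover have "a dvd pderiv a"
    using coprime eq by (metis coprime_dvd_mult_left_iff dvd_triv_left)
  ultimately have "degree a = 0" "degree b = 0" by simp_all
  then obtain c d where cd: "a = [:c:]" "b = [:d:]" by (metis degree_eq_zeroE)
  have "q = ratfun_const (c / d)"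
    using b by (simp add: q cd ratfun_const_def eq_fract)
  thus ?thesis by blast
qed

lemma fls_deriv_eq_0:
  assumes "fls_deriv (f :: complex fls) = 0" shows "f \<in> range fls_const"
  using assms fls_deriv_eq_0_iff by blast


section \<open>First-order representations are Casimir representations\<close>

lemma (in differential_field) first_order_rep_casimir:
  assumes constants: "\<And>f. \<delta> f = 0 \<Longrightarrow> f \<in> range \<kappa>"
    and "\<rho> \<in> first_order_reps \<kappa> \<delta>"
  shows "casimir_representation \<kappa> \<delta> \<rho>"
proof -
  from assms(2) have \<rho>: "\<rho> \<in> lie_homs \<kappa> \<delta>" and L: "has_order \<delta> (\<rho> (sl2_L 0)) 1"
    by (auto simp: first_order_reps_def)
  have Diff: "\<rho> x \<in> Diff \<delta>"
    and scale: "\<rho> (sl2_scale c x) = (\<lambda>f. \<kappa> c * \<rho> x f)"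
    and bracket: "\<rho> (sl2_bracket x y) = op_commutator (\<rho> x) (\<rho> y)" for c x y
    using \<rho> by (simp_all add: lie_homs_def)
  define Q where "Q = induced_hom \<kappa> \<delta> \<rho> casimir"
  have hom: "induced_hom \<kappa> \<delta> \<rho> u \<in> Diff \<delta>"
    "induced_hom \<kappa> \<delta> \<rho> (u * v) = induced_hom \<kappa> \<delta> \<rho> u \<circ> induced_hom \<kappa> \<delta> \<rho> v" for u v
    using induced_hom_alg_hom[OF \<rho>] by (simp_all add: alg_homs_def)
  have commute: "Q (\<rho> (sl2_L i) f) = \<rho> (sl2_L i) (Q f)" if "i \<in> {0, 1}" for i f
    using arg_cong[OF casimir_central_L0_L1[OF that], of "induced_hom \<kappa> \<delta> \<rho>"]
    unfolding hom(2) induced_hom_incl[OF \<rho>] Q_def by (simp add: fun_eq_iff)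
  have L1: "op_commutator (\<rho> (sl2_L 0)) (\<rho> (sl2_L 1)) = (\<lambda>f. \<kappa> (-1) * \<rho> (sl2_L 1) f)"
    using sl2_bracket_L[of 0 1] by (simp flip: bracket scale)
  have "\<rho> (sl2_L 1) \<noteq> (\<lambda>f. 0)"
  proof
    assume 0: "\<rho> (sl2_L 1) = (\<lambda>f. 0)"
    have "(\<lambda>f. \<kappa> 2 * \<rho> (sl2_L 0) f) = op_commutator (\<rho> (sl2_L 1)) (\<rho> (sl2_L (-1)))"
      using sl2_bracket_L[of 1 "-1"] by (simp flip: bracket scale)
    also have "\<dots> = (\<lambda>f. 0)"
      using Diff_scale[OF Diff, of _ 0] by (simp add: op_commutator_def 0 \<kappa>_0)
    finally have "\<rho> (sl2_L 0) = (\<lambda>f. 0)" by (simp add: fun_eq_iff \<kappa>_eq_0_iff)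
    hence "has_order \<delta> (\<lambda>f. 0) 1" using L by simp
    then obtain \<xi> where \<xi>: "(\<lambda>f. 0) = diff_op \<delta> 1 \<xi>" "\<xi> 1 \<noteq> 0"
      by (auto simp: has_order_def)
    have "diff_op \<delta> 1 (\<lambda>_. 0) = diff_op \<delta> 1 \<xi>"
      unfolding \<xi>(1)[symmetric] by (simp add: diff_op_def)
    from diff_op_coeffs_unique[OF this, of 1] \<xi>(2) show False by simp
  qed
  hence "\<exists>c. Q = (\<lambda>f. \<kappa> c * f)"
    using commute
    by (intro commutant_constant[OF constants L Diff _ _ _ L1])
       (simp_all add: op_commutator_def Q_def hom(1))
  thus ?thesis by (simp add: casimir_representation_def Q_def)
qed

theorem theorem3p1:
  shows "(\<forall>\<rho> \<in> first_order_reps ratfun_const ratfun_deriv.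
            casimir_representation ratfun_const ratfun_deriv \<rho>) \<and>
         (\<forall>\<rho> \<in> first_order_reps (fls_const :: complex \<Rightarrow> complex fls) fls_deriv.
            casimir_representation fls_const fls_deriv \<rho>)"
  using differential_field.first_order_rep_casimir[OF differential_field_ratfun ratfun_deriv_eq_0]
    differential_field.first_order_rep_casimir[OF differential_field_fls fls_deriv_eq_0]
  by blast

end
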